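(* Let $\alpha,\beta\in\mathbb R_0^+$ with $\alpha+\beta\ne0$, and let $a,b\in\mathbb R$ be such that $a<b$, $b\in\mathcal A:=\{a+k\alpha:k\in\mathbb N_0\}$ and $a\in\mathcal B:=\{b-k\beta:k\in\mathbb N_0\}$. Let $f,g:\mathbb R\to\mathbb R$ be bounded and $\alpha,\beta$-symmetric integrable on $[a,b]$, with $g$ nonnegative. Let $m$ and $M$ be the infimum and the supremum, respectively, of the function $f$. Then there exists a real number $K$ satisfying $m\le K\le M$ such that $$\int_a^bf(t)g(t)\,d_{\alpha,\beta}t=K\int_a^bg(t)\,d_{\alpha,\beta}t.$$
   Context: $\mathbb R_0^+=[0,\infty)$, $\mathbb N_0=\{0,1,2,\dots\}$. For $\alpha>0$, the $\alpha$-forward integral of $f:\mathbb R\to\mathbb R$ is $\int_a^bf(t)\Delta_\alpha t=\int_a^{+\infty}f(t)\Delta_\alpha t-\int_b^{+\infty}f(t)\Delta_\alpha t$, where $\int_x^{+\infty}f(t)\Delta_\alpha t=\alpha\sum_{k=0}^{+\infty}f(x+k\alpha)$; $f$ is $\alpha$-forward integrable on $[a,b]$ if the series converges at $x=a$ and $x=b$. For $\beta>0$, the $\beta$-backward integral is $\int_a^bf(t)\nabla_\beta t=\int_{-\infty}^bf(t)\nabla_\beta t-\int_{-\infty}^af(t)\nabla_\beta t$, where $\int_{-\infty}^xf(t)\nabla_\beta t=\beta\sum_{k=0}^{+\infty}f(x-k\beta)$; $f$ is $\beta$-backward integrable on $[a,b]$ if the series converges at $x=a$ and $x=b$. For $\alpha,\beta\ge0$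 with $\alpha+\beta>0$, $f$ is $\alpha,\beta$-symmetric integrable on $[a,b]$ if it is $\alpha$-forward and $\beta$-backward integrable on $[a,b]$ (if $\beta=0$ only the forward, if $\alpha=0$ only the backward integrability is required), and then $$\int_a^bf(t)\,d_{\alpha,\beta}t=\frac{\alpha}{\alpha+\beta}\int_a^bf(t)\Delta_\alpha t+\frac{\beta}{\alpha+\beta}\int_a^bf(t)\nabla_\beta t,$$ a term with coefficient $0$ being omitted. *)

theory Defs
  imports "HOL-Analysis.Elementary_Metric_Spaces"
begin

text \<open>The integrals are total functions; their values are meaningful only under the
  corresponding integrability predicates.\<close>

definition forward_tail :: "real \<Rightarrow> (real \<Rightarrow> real) \<Rightarrow> real \<Rightarrow> real" where
  "forward_tail \<alpha> f x = \<alpha> * (\<Sum>k. f (x + real k * \<alpha>))"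

definition forward_integrable :: "real \<Rightarrow> (real \<Rightarrow> real) \<Rightarrow> real \<Rightarrow> real \<Rightarrow> bool" where
  "forward_integrable \<alpha> f a b \<longleftrightarrow>
     summable (\<lambda>k. f (a + real k * \<alpha>)) \<and> summable (\<lambda>k. f (b + real k * \<alpha>))"

definition forward_integral :: "real \<Rightarrow> real \<Rightarrow> real \<Rightarrow> (real \<Rightarrow> real) \<Rightarrow> real" where
  "forward_integral \<alpha> a b f = forward_tail \<alpha> f a - forward_tail \<alpha> f b"

definition backward_tail :: "real \<Rightarrow> (real \<Rightarrow> real) \<Rightarrow> real \<Rightarrow> real" where
  "backward_tail \<beta> f x = \<beta> * (\<Sum>k. f (x - real k * \<beta>))"

definition backward_integrable :: "real \<Rightarrow> (real \<Rightarrow> real) \<Rightarrow> real \<Rightarrow> real \<Rightarrow> bool" where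
  "backward_integrable \<beta> f a b \<longleftrightarrow>
     summable (\<lambda>k. f (a - real k * \<beta>)) \<and> summable (\<lambda>k. f (b - real k * \<beta>))"

definition backward_integral :: "real \<Rightarrow> real \<Rightarrow> real \<Rightarrow> (real \<Rightarrow> real) \<Rightarrow> real" where
  "backward_integral \<beta> a b f = backward_tail \<beta> f b - backward_tail \<beta> f a"

text \<open>The symmetric notions are intended for nonnegative steps that are not both zero;
  a direction with step zero imposes no integrability condition.\<close>

definition symmetric_integrable ::
    "real \<Rightarrow> real \<Rightarrow> (real \<Rightarrow> real) \<Rightarrow> real \<Rightarrow> real \<Rightarrow> bool" where
  "symmetric_integrable \<alpha> \<beta> f a b \<longleftrightarrow>
     (\<alpha> \<noteq> 0 \<longrightarrow> forward_integrable \<alpha> f a b) \<and>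
     (\<beta> \<noteq> 0 \<longrightarrow> backward_integrable \<beta> f a b)"

text \<open>A term with coefficient zero vanishes whatever the (possibly meaningless) value of its
  one-sided integral, so it needs no separate case.\<close>

definition symmetric_integral ::
    "real \<Rightarrow> real \<Rightarrow> real \<Rightarrow> real \<Rightarrow> (real \<Rightarrow> real) \<Rightarrow> real" where
  "symmetric_integral \<alpha> \<beta> a b f =
     \<alpha> / (\<alpha> + \<beta>) * forward_integral \<alpha> a b f + \<beta> / (\<alpha> + \<beta>) * backward_integral \<beta> a b f"

end

theory Submission
  imports Defs
begin

text \<open>Since \<open>b\<close> lies on the forward lattice from \<open>a\<close> and \<open>a\<close> on the backward lattice from \<open>b\<close>,
  both one-sided integrals telescope to finite sums over lattice points. The symmetric integral
  is therefore a monotone linear functional, and \<open>m g \<le> f g \<le> M g\<close> gives the mean value.\<close>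

text \<open>The series at \<open>b\<close> is the series at \<open>a\<close> without its first
  \<open>n\<close> terms, so the infinite parts cancel. The point \<open>b\<close> itself is not
  sampled.\<close>

lemma forward_integral_lattice:
  assumes "forward_integrable \<alpha> f a b" and "b = a + real n * \<alpha>"
  shows "forward_integral \<alpha> a b f = \<alpha> * (\<Sum>k<n. f (a + real k * \<alpha>))"
proof -
  have "(\<Sum>k. f (a + real k * \<alpha>)) = (\<Sum>k. f (b + real k * \<alpha>)) + (\<Sum>k<n. f (a + real k * \<alpha>))"
    using suminf_split_initial_segment[of "\<lambda>k. f (a + real k * \<alpha>)" n] assms
    by (simp add: forward_integrable_def algebra_simps)
  then show ?thesis
    by (simp add: forward_integral_def forward_tail_def algebra_simps)
qed

text \<open>Mirror image of the forward case: the series at \<open>a\<close> is the series at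
  \<open>b\<close> from index \<open>n\<close> on. Here \<open>a\<close> is the endpoint left
  out.\<close>

lemma backward_integral_lattice:
  assumes "backward_integrable \<beta> f a b" and "a = b - real n * \<beta>"
  shows "backward_integral \<beta> a b f = \<beta> * (\<Sum>k<n. f (b - real k * \<beta>))"
proof -
  have "(\<Sum>k. f (b - real k * \<beta>)) = (\<Sum>k. f (a - real k * \<beta>)) + (\<Sum>k<n. f (b - real k * \<beta>))"
    using suminf_split_initial_segment[of "\<lambda>k. f (b - real k * \<beta>)" n] assms
    by (simp add: backward_integrable_def distrib_right diff_diff_eq add.commute)
  then show ?thesis
    by (simp add: backward_integral_def backward_tail_def algebra_simps)
qed

text \<open>Nonnegativity of \<open>g\<close> makes its series absolutely convergent, so a bound on
  \<open>\<bar>f\<bar>\<close> suffices for comparison. The sequence \<open>x\<close> stands for any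
  of the forward or backward lattices through \<open>a\<close> or \<open>b\<close>.\<close>

lemma summable_bounded_mult_nonneg:
  fixes f g :: "'a \<Rightarrow> real" and x :: "nat \<Rightarrow> 'a"
  assumes "bounded (range f)" and "\<And>t. 0 \<le> g t" and "summable (\<lambda>k. g (x k))"
  shows "summable (\<lambda>k. f (x k) * g (x k))"
proof -
  obtain C where C: "\<And>t. \<bar>f t\<bar> \<le> C"
    using assms(1) by (auto simp: bounded_iff)
  show ?thesis
  proof (rule summable_comparison_test')
    show "summable (\<lambda>k. C * g (x k))"
      using assms(3) by (rule summable_mult)
    show "norm (f (x k) * g (x k)) \<le> C * g (x k)" for k
      using C[of "x k"] assms(2)[of "x k"] by (simp add: abs_mult mult_right_mono)
  qed
qed

lemma symmetric_integrable_bounded_mult: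
  assumes "bounded (range f)" and "\<And>t. 0 \<le> g t" and "symmetric_integrable \<alpha> \<beta> g a b"
  shows "symmetric_integrable \<alpha> \<beta> (\<lambda>t. f t * g t) a b"
  using assms(3) summable_bounded_mult_nonneg[where g = g, OF assms(1,2)]
  by (simp add: symmetric_integrable_def forward_integrable_def backward_integrable_def)

lemma symmetric_integrable_cmult:
  assumes "symmetric_integrable \<alpha> \<beta> g a b"
  shows "symmetric_integrable \<alpha> \<beta> (\<lambda>t. c * g t) a b"
  using assms
  by (simp add: symmetric_integrable_def forward_integrable_def backward_integrable_def
      summable_mult)

lemma symmetric_integral_cmult:
  assumes "symmetric_integrable \<alpha> \<beta> g a b"
  shows "symmetric_integral \<alpha> \<beta> a b (\<lambda>t. c * g t) = c * symmetric_integral \<alpha> \<beta> a b g"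
proof -
  have "\<alpha> * forward_integral \<alpha> a b (\<lambda>t. c * g t) = c * (\<alpha> * forward_integral \<alpha> a b g)"
    \<comment> \<open>For step 0 no convergence is known, but the factor \<open>\<alpha>\<close>
      makes both sides 0; otherwise the constant is pulled out of each convergent series.\<close>
    using assms by (cases "\<alpha> = 0") (simp_all add: symmetric_integrable_def forward_integrable_def
      forward_integral_def forward_tail_def suminf_mult algebra_simps)
  moreover have "\<beta> * backward_integral \<beta> a b (\<lambda>t. c * g t) = c * (\<beta> * backward_integral \<beta> a b g)"
    using assms by (cases "\<beta> = 0") (simp_all add: symmetric_integrable_def backward_integrable_def
      backward_integral_def backward_tail_def suminf_mult algebra_simps)
  ultimately show ?thesis
    by (auto simp: symmetric_integral_def distrib_left mult.left_commute)
qed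

text \<open>A difference of two series need not be monotone in the integrand. The lattice conditions
  turn it into a finite sum with nonnegative weights, which is.\<close>

lemma symmetric_integral_mono:
  assumes "0 \<le> \<alpha>" and "0 \<le> \<beta>"
    and b: "b = a + real n * \<alpha>" and a: "a = b - real l * \<beta>"
    and f: "symmetric_integrable \<alpha> \<beta> f a b" and g: "symmetric_integrable \<alpha> \<beta> g a b"
    and le: "\<And>t. f t \<le> g t"
  shows "symmetric_integral \<alpha> \<beta> a b f \<le> symmetric_integral \<alpha> \<beta> a b g"
proof -
  have "\<alpha> / (\<alpha> + \<beta>) * forward_integral \<alpha> a b f \<le> \<alpha> / (\<alpha> + \<beta>) * forward_integral \<alpha> a b g"
  proof (cases "\<alpha> = 0")
    case False
    then have "forward_integral \<alpha> a b f \<le> forward_integral \<alpha> a b g"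
      using f g \<open>0 \<le> \<alpha>\<close> le
      by (simp add: symmetric_integrable_def forward_integral_lattice[OF _ b] sum_mono
          mult_left_mono)
    then show ?thesis
      using \<open>0 \<le> \<alpha>\<close> \<open>0 \<le> \<beta>\<close> by (intro mult_left_mono) auto
  qed simp
  moreover have "\<beta> / (\<alpha> + \<beta>) * backward_integral \<beta> a b f \<le> \<beta> / (\<alpha> + \<beta>) * backward_integral \<beta> a b g"
  proof (cases "\<beta> = 0")
    case False
    then have "backward_integral \<beta> a b f \<le> backward_integral \<beta> a b g"
      using f g \<open>0 \<le> \<beta>\<close> le
      by (simp add: symmetric_integrable_def backward_integral_lattice[OF _ a] sum_mono
          mult_left_mono)
    then show ?thesis
      using \<open>0 \<le> \<alpha>\<close> \<open>0 \<le> \<beta>\<close> by (intro mult_left_mono) auto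
  qed simp
  ultimately show ?thesis
    unfolding symmetric_integral_def by (rule add_mono)
qed

theorem theorem5p3p16:
  fixes \<alpha> \<beta> a b m M :: real and f g :: "real \<Rightarrow> real"
  assumes "0 \<le> \<alpha>" and "0 \<le> \<beta>" and "\<alpha> + \<beta> \<noteq> 0"
    and "a < b"
    and "b \<in> {a + real k * \<alpha> | k :: nat. True}"
    and "a \<in> {b - real k * \<beta> | k :: nat. True}"
    and "bounded (range f)" and "bounded (range g)"
    and "symmetric_integrable \<alpha> \<beta> f a b" and "symmetric_integrable \<alpha> \<beta> g a b"
    and "\<And>t. 0 \<le> g t"
    and "m = Inf (range f)" and "M = Sup (range f)"
  shows "symmetric_integrable \<alpha> \<beta> (\<lambda>t. f t * g t) a b \<and>
    (\<exists>K. m \<le> K \<and> K \<le> M \<and>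
      symmetric_integral \<alpha> \<beta> a b (\<lambda>t. f t * g t) = K * symmetric_integral \<alpha> \<beta> a b g)"
proof
  let ?I = "symmetric_integral \<alpha> \<beta> a b"
  note gi = \<open>symmetric_integrable \<alpha> \<beta> g a b\<close> and g0 = \<open>\<And>t. 0 \<le> g t\<close>
  show fgi: "symmetric_integrable \<alpha> \<beta> (\<lambda>t. f t * g t) a b"
    using \<open>bounded (range f)\<close> g0 gi by (rule symmetric_integrable_bounded_mult)
  obtain n l where b: "b = a + real n * \<alpha>" and a: "a = b - real l * \<beta>"
    using assms(5,6) by blast
  note mono = symmetric_integral_mono[OF \<open>0 \<le> \<alpha>\<close> \<open>0 \<le> \<beta>\<close> b a]
  \<comment> \<open>Boundedness ensures that \<open>Inf\<close> and \<open>Sup\<close> are genuine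
    bounds of the range.\<close>
  have m: "m \<le> f t" and M: "f t \<le> M" for t
    using \<open>bounded (range f)\<close> \<open>m = Inf (range f)\<close> \<open>M = Sup (range f)\<close>
    by (auto intro: cInf_lower cSup_upper bounded_imp_bdd_below bounded_imp_bdd_above)
  have "?I (\<lambda>t. m * g t) \<le> ?I (\<lambda>t. f t * g t)"
    using m g0 by (intro mono symmetric_integrable_cmult gi fgi mult_right_mono)
  then have lower: "m * ?I g \<le> ?I (\<lambda>t. f t * g t)"
    by (simp add: symmetric_integral_cmult[OF gi])
  have "?I (\<lambda>t. f t * g t) \<le> ?I (\<lambda>t. M * g t)"
    using M g0 by (intro mono symmetric_integrable_cmult gi fgi mult_right_mono)
  then have upper: "?I (\<lambda>t. f t * g t) \<le> M * ?I g"
    by (simp add: symmetric_integral_cmult[OF gi])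
  \<comment> \<open>The zero function is written as a multiple of \<open>g\<close>, so that its
    integrability and its integral come from the scaling lemmas.\<close>
  have "?I (\<lambda>t. 0 * g t) \<le> ?I g"
    using g0 by (intro mono symmetric_integrable_cmult gi) simp
  then have "0 \<le> ?I g"
    by (simp only: symmetric_integral_cmult[OF gi])
  show "\<exists>K. m \<le> K \<and> K \<le> M \<and> ?I (\<lambda>t. f t * g t) = K * ?I g"
  proof (cases "?I g = 0")
    case True
    then show ?thesis
      \<comment> \<open>Both bounds collapse to 0, so the integral of the product vanishes and any
        \<open>K\<close> in the range works. Any value of \<open>f\<close>, here at 0, shows
        \<open>m \<le> M\<close>.\<close>
      using lower upper m[of 0] M[of 0] by (intro exI[of _ m]) auto
  next
    case False
    with \<open>0 \<le> ?I g\<close> have "0 < ?I g"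
      by simp
    then show ?thesis
      \<comment> \<open>The only possible \<open>K\<close> is the quotient of the integrals;
        dividing \<open>lower\<close> and \<open>upper\<close> by the positive integral of
        \<open>g\<close> places it between \<open>m\<close> and \<open>M\<close>.\<close>
      using lower upper by (intro exI[of _ "?I (\<lambda>t. f t * g t) / ?I g"]) (simp add: field_simps)
  qed
qed

end
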